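(* For every regular language $L$ over a unary alphabet, $L\in\mathcal{L}(\mathsf{DRX})$, i.e. there is a deterministic regex $\alpha$ with $\mathcal{L}(\alpha)=L$.
   Context: Regex. Let $\Sigma$ be a finite terminal alphabet and $\Xi$ an infinite variable alphabet disjoint from $\Sigma$. The set $\mathsf{RX}$ of regex, with $\mathsf{var}(\alpha)\subset\Xi$ the set of variables occurring in $\alpha$, is defined recursively: every $a\in\Sigma\cup\{\varepsilon\}$ is a regex; $\&x$ (variable reference) for $x\in\Xi$; $(\alpha\cdot\beta)$, $(\alpha\vee\beta)$, $(\alpha^+)$ for $\alpha,\beta\in\mathsf{RX}$; and $\langle x:\alpha\rangle$ (variable binding) for $\alpha\in\mathsf{RX}$ and $x\in\Xi\setminus\mathsf{var}(\alpha)$. Also $\emptyset$ is a regex, but may not occur inside another regex. $\alpha^*$ abbreviates $\varepsilon\vee\alpha^+$; a nonempty set $A\subseteq\Sigma$ abbreviates $\bigvee_{a\in A}a$. Let $\Gamma=\{[_x,]_x\mid x\in\Xi\}$. The ref-language $\mathcal{R}(\alpha)\subseteq(\Sigma\cup\Xi\cup\Gamma)^*$ is given by $\mathcal{R}(\emptyset)=\emptyset$, $\mathcal{R}(a)=\{a\}$ for $a\in\Sigma\cup\{\varepsilon\}$, $\mathcal{R}(\&x)=\{x\}$, $\mathcal{R}(\langle x:\alpha\rangle)=[_x\mathcal{R}(\alpha)]_x$, $\mathcal{R}(\alpha\cdot\beta)=\mathcal{R}(\alpha)\mathcal{R}(\beta)$, $\mathcal{R}(\alpha\vee\beta)=\mathcal{R}(\alpha)\cup\mathcal{R}(\beta)$,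 $\mathcal{R}(\alpha^+)=\mathcal{R}(\alpha)^+$. For $r\in\mathcal{R}(\alpha)$, the dereference $\mathcal{D}(r)\in\Sigma^*$ is obtained by replacing each occurrence of a variable $x$ by $v$, where $[_x v]_x$ is the nearest such factor to the left of this occurrence (or by $\varepsilon$ if there is none; variables inside $v$ are replaced likewise), and then deleting all symbols of $\Gamma$. $\mathcal{L}(\alpha)=\{\mathcal{D}(r)\mid r\in\mathcal{R}(\alpha)\}$. Deterministic regex. Let $\alpha_{\mathcal{R}}$ be the regular expression over $\Sigma\cup\Xi\cup\Gamma$ obtained from $\alpha$ by replacing each $\langle x:\beta\rangle$ by $[_x\beta_{\mathcal{R}}]_x$ and each $\&x$ by $x$. The marked regex $\tilde\alpha$ is obtained from $\alpha_{\mathcal{R}}$ by attaching to each occurrence of a symbol $\chi\in\Sigma\cup\Xi\cup\Gamma$ its own unique number $i$, written $\chi_{(i)}$; $\mathcal{R}(\tilde\alpha)$ is the language of marked ref-words it generates. $\tilde A$ denotes the set of marked symbols from $A$. A regex $\alpha$ is not deterministic if there exist $\rho_1,\rho_2\in\mathcal{R}(\tilde\alpha)$, $r,s_1,s_2\in(\tilde\Sigma\cup\tilde\Xi\cup\tilde\Gamma)^*$ and $\gamma_1,\gamma_2\in\tilde\Gamma^*$ such that one of the following holds: (1) $\rho_1=r\gamma_1a_{(i)}s_1$ and $\rho_2=r\gamma_2a_{(j)}s_2$ with $a\in\Sigma$, $i\ne j$; (2) $\rho_1=r\gamma_1x_{(i)}s_1$ and $\rho_2=r\gamma_2\chi_{(j)}s_2$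 with $x\in\Xi$, $\chi\in\Sigma\cup\Xi$, $i\neq j$; (3) $\rho_1=r\gamma_1\chi_{(i)}s_1$ and $\rho_2=r\gamma_2\chi_{(i)}s_2$ with $\chi\in\Sigma\cup\Xi$, $\gamma_1\ne\gamma_2$; (4) $\rho_1=r\gamma_1$ and $\rho_2=r\gamma_2$ with $\gamma_1\neq\gamma_2$. Otherwise $\alpha$ is deterministic. $\mathsf{DRX}$ is the set of deterministic regex, and $\mathcal{L}(\mathsf{DRX})=\{\mathcal{L}(\alpha)\mid\alpha\in\mathsf{DRX}\}$. *)

theory Defs
  imports "HOL-Library.Infinite_Typeclass"
begin

section \<open>Languages\<close>

definition conc :: "'s list set \<Rightarrow> 's list set \<Rightarrow> 's list set" where
  "conc A B = {u @ v | u v. u \<in> A \<and> v \<in> B}"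

definition lplus :: "'s list set \<Rightarrow> 's list set" where
  "lplus A = {concat ws | ws. ws \<noteq> [] \<and> set ws \<subseteq> A}"

text \<open>Regular languages over an alphabet, as the languages accepted by complete deterministic
  finite automata. As state sets are finite, natural numbers suffice as states.\<close>

definition regular :: "'a set \<Rightarrow> 'a list set \<Rightarrow> bool" where
  "regular \<Sigma> L \<longleftrightarrow>
    (\<exists>(Q :: nat set) q0 F \<delta>. finite Q \<and> q0 \<in> Q \<and> F \<subseteq> Q \<and>
      (\<forall>q\<in>Q. \<forall>a\<in>\<Sigma>. \<delta> q a \<in> Q) \<and>
      L = {w \<in> lists \<Sigma>. foldl \<delta> q0 w \<in> F})"


section \<open>Regex and their ref-languages\<close>

datatype ('a, 'v) regex =
    Empty
  | Eps
  | Lit 'a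
  | Ref 'v
  | Bind 'v "('a, 'v) regex"
  | Cat "('a, 'v) regex" "('a, 'v) regex"
  | Alt "('a, 'v) regex" "('a, 'v) regex"
  | Iter "('a, 'v) regex"

fun vars :: "('a, 'v) regex \<Rightarrow> 'v set" where
  "vars Empty = {}"
| "vars Eps = {}"
| "vars (Lit a) = {}"
| "vars (Ref x) = {x}"
| "vars (Bind x \<alpha>) = insert x (vars \<alpha>)"
| "vars (Cat \<alpha> \<beta>) = vars \<alpha> \<union> vars \<beta>"
| "vars (Alt \<alpha> \<beta>) = vars \<alpha> \<union> vars \<beta>"
| "vars (Iter \<alpha>) = vars \<alpha>"

text \<open>The formation rules; \<open>Empty\<close> is admitted only at top level.\<close>

inductive_set RX_core :: "'a set \<Rightarrow> ('a, 'v) regex set" for \<Sigma> :: "'a set" where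
  "Eps \<in> RX_core \<Sigma>"
| "a \<in> \<Sigma> \<Longrightarrow> Lit a \<in> RX_core \<Sigma>"
| "Ref x \<in> RX_core \<Sigma>"
| "\<alpha> \<in> RX_core \<Sigma> \<Longrightarrow> x \<notin> vars \<alpha> \<Longrightarrow> Bind x \<alpha> \<in> RX_core \<Sigma>"
| "\<alpha> \<in> RX_core \<Sigma> \<Longrightarrow> \<beta> \<in> RX_core \<Sigma> \<Longrightarrow> Cat \<alpha> \<beta> \<in> RX_core \<Sigma>"
| "\<alpha> \<in> RX_core \<Sigma> \<Longrightarrow> \<beta> \<in> RX_core \<Sigma> \<Longrightarrow> Alt \<alpha> \<beta> \<in> RX_core \<Sigma>"
| "\<alpha> \<in> RX_core \<Sigma> \<Longrightarrow> Iter \<alpha> \<in> RX_core \<Sigma>"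

definition RX :: "'a set \<Rightarrow> ('a, 'v) regex set" where
  "RX \<Sigma> = insert Empty (RX_core \<Sigma>)"

text \<open>The disjoint union of \<open>\<Sigma>\<close>, \<open>\<Xi>\<close> and \<open>\<Gamma>\<close>: \<open>Opn x\<close> and \<open>Cls x\<close> are the brackets of \<open>x\<close>.\<close>

datatype ('a, 'v) symb = Ter 'a | Var 'v | Opn 'v | Cls 'v

fun is_bracket :: "('a, 'v) symb \<Rightarrow> bool" where
  "is_bracket (Ter a) = False"
| "is_bracket (Var x) = False"
| "is_bracket (Opn x) = True"
| "is_bracket (Cls x) = True"

fun ref_lang :: "('a, 'v) regex \<Rightarrow> ('a, 'v) symb list set" where
  "ref_lang Empty = {}"
| "ref_lang Eps = {[]}"
| "ref_lang (Lit a) = {[Ter a]}"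
| "ref_lang (Ref x) = {[Var x]}"
| "ref_lang (Bind x \<alpha>) = conc {[Opn x]} (conc (ref_lang \<alpha>) {[Cls x]})"
| "ref_lang (Cat \<alpha> \<beta>) = conc (ref_lang \<alpha>) (ref_lang \<beta>)"
| "ref_lang (Alt \<alpha> \<beta>) = ref_lang \<alpha> \<union> ref_lang \<beta>"
| "ref_lang (Iter \<alpha>) = lplus (ref_lang \<alpha>)"


section \<open>Dereferencing\<close>

text \<open>For the part \<open>p\<close> of a ref-word to the left of an occurrence of \<open>x\<close>, the nearest factor
  \<open>[\<^sub>x v ]\<^sub>x\<close> of \<open>p\<close>, given as the pair of the part \<open>u\<close> of \<open>p\<close> preceding that factor and \<open>v\<close>.
  See \<open>nearest_binding_eq_Some_iff\<close> below.\<close>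

definition nearest_binding ::
  "'v \<Rightarrow> ('a, 'v) symb list \<Rightarrow> (('a, 'v) symb list \<times> ('a, 'v) symb list) option" where
  "nearest_binding x p =
    (case dropWhile (\<lambda>s. s \<noteq> Cls x) (rev p) of
       [] \<Rightarrow> None
     | _ # q \<Rightarrow>
        (case dropWhile (\<lambda>s. s \<noteq> Opn x) q of
           [] \<Rightarrow> None
         | _ # u \<Rightarrow> Some (rev u, rev (takeWhile (\<lambda>s. s \<noteq> Opn x) q))))"

lemma dropWhile_neq_eq_Cons_iff:
  "dropWhile (\<lambda>s. s \<noteq> c) xs = d # ys \<longleftrightarrow>
    d = c \<and> (\<exists>zs. xs = zs @ c # ys \<and> c \<notin> set zs)"
proof
  assume *: "dropWhile (\<lambda>s. s \<noteq> c) xs = d # ys"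
  then have d: "d = c"
    by (auto simp: dropWhile_eq_Cons_conv)
  have "xs = takeWhile (\<lambda>s. s \<noteq> c) xs @ c # ys"
    using * d takeWhile_dropWhile_id[of "\<lambda>s. s \<noteq> c" xs] by simp
  then show "d = c \<and> (\<exists>zs. xs = zs @ c # ys \<and> c \<notin> set zs)"
    using d by (metis (mono_tags, lifting) set_takeWhileD)
next
  assume "d = c \<and> (\<exists>zs. xs = zs @ c # ys \<and> c \<notin> set zs)"
  then obtain zs where "d = c" "xs = zs @ c # ys" "c \<notin> set zs" by blast
  moreover from \<open>c \<notin> set zs\<close> have "\<And>s. s \<in> set zs \<Longrightarrow> s \<noteq> c" by blast
  ultimately show "dropWhile (\<lambda>s. s \<noteq> c) xs = d # ys"
    by (simp add: dropWhile_append2)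
qed

lemma nearest_binding_eq_Some_iff:
  "nearest_binding x p = Some (u, v) \<longleftrightarrow>
    (\<exists>w. p = u @ Opn x # v @ Cls x # w \<and> Cls x \<notin> set w \<and> Opn x \<notin> set v)"
proof
  assume "nearest_binding x p = Some (u, v)"
  then obtain c q d u' where
    1: "dropWhile (\<lambda>s. s \<noteq> Cls x) (rev p) = c # q" and
    2: "dropWhile (\<lambda>s. s \<noteq> Opn x) q = d # u'" and
    uv: "u = rev u'" "v = rev (takeWhile (\<lambda>s. s \<noteq> Opn x) q)"
    by (auto simp: nearest_binding_def split: list.splits)
  from 1 obtain w where w: "rev p = w @ Cls x # q" "Cls x \<notin> set w"
    unfolding dropWhile_neq_eq_Cons_iff by blast
  from 2 have d: "d = Opn x"
    unfolding dropWhile_neq_eq_Cons_iff by blast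
  have "q = rev v @ Opn x # rev u"
    using takeWhile_dropWhile_id[of "\<lambda>s. s \<noteq> Opn x" q] 2 d uv by simp
  with w have "rev p = rev (u @ Opn x # v @ Cls x # rev w)" by simp
  then have "p = u @ Opn x # v @ Cls x # rev w"
    unfolding rev_is_rev_conv .
  moreover have "Opn x \<notin> set v"
    using uv by (auto dest: set_takeWhileD)
  ultimately show "\<exists>w. p = u @ Opn x # v @ Cls x # w \<and> Cls x \<notin> set w \<and> Opn x \<notin> set v"
    using w(2) by (metis set_rev)
next
  assume "\<exists>w. p = u @ Opn x # v @ Cls x # w \<and> Cls x \<notin> set w \<and> Opn x \<notin> set v"
  then obtain w where p: "p = u @ Opn x # v @ Cls x # w" and
    "Cls x \<notin> set w" "Opn x \<notin> set v" by blast
  then have w: "\<And>s. s \<in> set (rev w) \<Longrightarrow> s \<noteq> Cls x"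
    and v: "\<And>s. s \<in> set (rev v) \<Longrightarrow> s \<noteq> Opn x" by auto
  have "dropWhile (\<lambda>s. s \<noteq> Cls x) (rev p) = Cls x # rev v @ Opn x # rev u"
    using dropWhile_append2[of "rev w" "\<lambda>s. s \<noteq> Cls x"] w by (simp add: p)
  moreover have "dropWhile (\<lambda>s. s \<noteq> Opn x) (rev v @ Opn x # rev u) = Opn x # rev u"
    using dropWhile_append2[of "rev v" "\<lambda>s. s \<noteq> Opn x"] v by simp
  moreover have "takeWhile (\<lambda>s. s \<noteq> Opn x) (rev v @ Opn x # rev u) = rev v"
    using takeWhile_append2[of "rev v" "\<lambda>s. s \<noteq> Opn x"] v by simp
  ultimately show "nearest_binding x p = Some (u, v)"
    by (simp add: nearest_binding_def)
qed

text \<open>\<open>deref_from p r\<close> dereferences the factor \<open>r\<close> of a ref-word in which \<open>r\<close> is preceded by \<open>p\<close>.\<close>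

function deref_from :: "('a, 'v) symb list \<Rightarrow> ('a, 'v) symb list \<Rightarrow> 'a list" where
  "deref_from p [] = []"
| "deref_from p (Ter a # r) = a # deref_from (p @ [Ter a]) r"
| "deref_from p (Var x # r) =
    (case nearest_binding x p of
       None \<Rightarrow> []
     | Some (u, v) \<Rightarrow> deref_from (u @ [Opn x]) v) @ deref_from (p @ [Var x]) r"
| "deref_from p (Opn x # r) = deref_from (p @ [Opn x]) r"
| "deref_from p (Cls x # r) = deref_from (p @ [Cls x]) r"
  by pat_completeness auto
termination
  by (relation "measures [\<lambda>(p, r). length p + length r, \<lambda>(p, r). length r]")
     (auto simp: nearest_binding_eq_Some_iff)

definition deref :: "('a, 'v) symb list \<Rightarrow> 'a list" where
  "deref r = deref_from [] r"

definition lang :: "('a, 'v) regex \<Rightarrow> 'a list set" where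
  "lang \<alpha> = {deref r | r. r \<in> ref_lang \<alpha>}"


section \<open>Deterministic regex\<close>

text \<open>Proper regular expressions, without variables, over an arbitrary set of symbols.\<close>

datatype 's rexp =
    RZero
  | ROne
  | RAtom 's
  | RTimes "'s rexp" "'s rexp"
  | RSum "'s rexp" "'s rexp"
  | RPlus "'s rexp"

fun rexp_lang :: "'s rexp \<Rightarrow> 's list set" where
  "rexp_lang RZero = {}"
| "rexp_lang ROne = {[]}"
| "rexp_lang (RAtom s) = {[s]}"
| "rexp_lang (RTimes e f) = conc (rexp_lang e) (rexp_lang f)"
| "rexp_lang (RSum e f) = rexp_lang e \<union> rexp_lang f"
| "rexp_lang (RPlus e) = lplus (rexp_lang e)"

fun rexp_of :: "('a, 'v) regex \<Rightarrow> ('a, 'v) symb rexp" where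
  "rexp_of Empty = RZero"
| "rexp_of Eps = ROne"
| "rexp_of (Lit a) = RAtom (Ter a)"
| "rexp_of (Ref x) = RAtom (Var x)"
| "rexp_of (Bind x \<alpha>) = RTimes (RAtom (Opn x)) (RTimes (rexp_of \<alpha>) (RAtom (Cls x)))"
| "rexp_of (Cat \<alpha> \<beta>) = RTimes (rexp_of \<alpha>) (rexp_of \<beta>)"
| "rexp_of (Alt \<alpha> \<beta>) = RSum (rexp_of \<alpha>) (rexp_of \<beta>)"
| "rexp_of (Iter \<alpha>) = RPlus (rexp_of \<alpha>)"

lemma rexp_lang_rexp_of: "rexp_lang (rexp_of \<alpha>) = ref_lang \<alpha>"
  by (induction \<alpha>) simp_all

fun atoms :: "'s rexp \<Rightarrow> 's list" where
  "atoms RZero = []"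
| "atoms ROne = []"
| "atoms (RAtom s) = [s]"
| "atoms (RTimes e f) = atoms e @ atoms f"
| "atoms (RSum e f) = atoms e @ atoms f"
| "atoms (RPlus e) = atoms e"

text \<open>\<open>mark n e\<close> numbers the occurrences of symbols in \<open>e\<close> consecutively from left to right,
  starting with \<open>n\<close>.\<close>

fun mark :: "nat \<Rightarrow> 's rexp \<Rightarrow> ('s \<times> nat) rexp" where
  "mark n RZero = RZero"
| "mark n ROne = ROne"
| "mark n (RAtom s) = RAtom (s, n)"
| "mark n (RTimes e f) = RTimes (mark n e) (mark (n + length (atoms e)) f)"
| "mark n (RSum e f) = RSum (mark n e) (mark (n + length (atoms e)) f)"
| "mark n (RPlus e) = RPlus (mark n e)"

lemma map_fst_atoms_mark: "map fst (atoms (mark n e)) = atoms e"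
  by (induction e arbitrary: n) simp_all

lemma map_snd_atoms_mark: "map snd (atoms (mark n e)) = [n..<n + length (atoms e)]"
proof (induction e arbitrary: n)
  case (RTimes e f)
  then show ?case
    using upt_add_eq_append[of n "n + length (atoms e)" "length (atoms f)"]
    by (simp add: ac_simps)
next
  case (RSum e f)
  then show ?case
    using upt_add_eq_append[of n "n + length (atoms e)" "length (atoms f)"]
    by (simp add: ac_simps)
qed simp_all

definition marked_lang :: "('a, 'v) regex \<Rightarrow> (('a, 'v) symb \<times> nat) list set" where
  "marked_lang \<alpha> = rexp_lang (mark 0 (rexp_of \<alpha>))"

definition marked_brackets :: "(('a, 'v) symb \<times> nat) set" where
  "marked_brackets = {(s, i). is_bracket s}"

definition not_deterministic :: "('a, 'v) regex \<Rightarrow> bool" where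
  "not_deterministic \<alpha> \<longleftrightarrow>
    (\<exists>\<rho>1 \<in> marked_lang \<alpha>. \<exists>\<rho>2 \<in> marked_lang \<alpha>. \<exists>r s1 s2.
     \<exists>\<gamma>1 \<in> lists marked_brackets. \<exists>\<gamma>2 \<in> lists marked_brackets.
       (\<exists>a i j. \<rho>1 = r @ \<gamma>1 @ (Ter a, i) # s1 \<and> \<rho>2 = r @ \<gamma>2 @ (Ter a, j) # s2 \<and> i \<noteq> j) \<or>
       (\<exists>x \<chi> i j. \<rho>1 = r @ \<gamma>1 @ (Var x, i) # s1 \<and> \<rho>2 = r @ \<gamma>2 @ (\<chi>, j) # s2 \<and>
          \<not> is_bracket \<chi> \<and> i \<noteq> j) \<or>
       (\<exists>\<chi> i. \<rho>1 = r @ \<gamma>1 @ (\<chi>, i) # s1 \<and> \<rho>2 = r @ \<gamma>2 @ (\<chi>, i) # s2 \<and>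
          \<not> is_bracket \<chi> \<and> \<gamma>1 \<noteq> \<gamma>2) \<or>
       (\<rho>1 = r @ \<gamma>1 \<and> \<rho>2 = r @ \<gamma>2 \<and> \<gamma>1 \<noteq> \<gamma>2))"

definition DRX :: "'a set \<Rightarrow> ('a, 'v) regex set" where
  "DRX \<Sigma> = {\<alpha> \<in> RX \<Sigma>. \<not> not_deterministic \<alpha>}"

end

theory Submission imports Defs "HOL-Library.Infinite_Set" begin

text \<open>Over a unary alphabet the ref-words of a deterministic regex form a chain of prefixes, so the
  lengths of the words of an infinite \<open>L\<close> have to be produced by a prefix followed by iterations of
  a single ref-word \<open>w\<close>. The gaps between consecutive lengths are eventually periodic, say of period
  \<open>k\<close>, and the \<open>n\<close>-th iteration of \<open>w\<close> must contribute the \<open>n\<close>-th gap. To this end, exactly one of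
  the variables \<open>x 0, \<dots>, x (k - 1)\<close> has value \<open>a\<close> and the others are empty; \<open>w\<close> moves this token to
  the next variable, which costs one letter, and then reads each \<open>x j\<close> a suitable number \<open>e j\<close> of
  times, which adds just \<open>e j\<close> letters for the current position \<open>j\<close> of the token. Passing from
  \<open>x (k - 1)\<close> back to \<open>x 0\<close> needs an auxiliary variable and costs two letters. So the gap at that
  point has to be at least 2, which is arranged by starting at an element of \<open>L\<close> whose predecessor is
  not in \<open>L\<close>; if there are no such elements beyond some bound, a loop over \<open>a\<close> does.\<close>

section \<open>Determinism of prefix chains\<close>

text \<open>Comparability of any two words in the prefix order excludes the first three clauses of
  nondeterminism. That the surplus \<open>g\<close> is empty or contains a non-bracket excludes the
  fourth.\<close>

definition bracket_chain :: "(('a, 'v) symb \<times> nat) list set \<Rightarrow> bool" where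
  "bracket_chain M \<longleftrightarrow> (\<forall>u\<in>M. \<forall>v\<in>M. \<exists>g. (u = v @ g \<or> v = u @ g) \<and>
     (g = [] \<or> g \<notin> lists marked_brackets))"

lemma first_non_bracket_unique:
  assumes "\<gamma>1 @ c # s = \<gamma>2 @ d # t"
    and "\<gamma>1 \<in> lists B" "\<gamma>2 \<in> lists B" "c \<notin> B" "d \<notin> B"
  shows "\<gamma>1 = \<gamma>2 \<and> c = d"
  using assms
proof (induction \<gamma>1 arbitrary: \<gamma>2)
  case Nil
  then show ?case by (cases \<gamma>2) auto
next
  case (Cons b \<gamma>1)
  then show ?case by (cases \<gamma>2) auto
qed

text \<open>Appending \<open>g\<close> to one of the two words makes them equal, and a single word
  has only one first non-bracket after \<open>r\<close>.\<close>

lemma bracket_chain_first_non_bracket: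
  assumes "bracket_chain M" and "r @ \<gamma>1 @ c # s \<in> M" and "r @ \<gamma>2 @ d # t \<in> M"
    and "\<gamma>1 \<in> lists marked_brackets" "\<gamma>2 \<in> lists marked_brackets"
    and "c \<notin> marked_brackets" "d \<notin> marked_brackets"
  shows "\<gamma>1 = \<gamma>2 \<and> c = d"
proof -
  obtain g where "r @ \<gamma>1 @ c # s = (r @ \<gamma>2 @ d # t) @ g \<or> r @ \<gamma>2 @ d # t = (r @ \<gamma>1 @ c # s) @ g"
    using assms(1-3) unfolding bracket_chain_def by blast
  then have "\<gamma>1 @ c # s = \<gamma>2 @ d # (t @ g) \<or> \<gamma>1 @ c # (s @ g) = \<gamma>2 @ d # t" by auto
  with first_non_bracket_unique assms(4-7) show ?thesis by metis
qed

text \<open>Here the surplus of one word over the other consists of brackets only, so it must be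
  empty.\<close>

lemma bracket_chain_bracket_suffix:
  assumes "bracket_chain M" and "r @ \<gamma>1 \<in> M" "r @ \<gamma>2 \<in> M"
    and "\<gamma>1 \<in> lists marked_brackets" "\<gamma>2 \<in> lists marked_brackets"
  shows "\<gamma>1 = \<gamma>2"
proof -
  obtain g where "r @ \<gamma>1 = (r @ \<gamma>2) @ g \<or> r @ \<gamma>2 = (r @ \<gamma>1) @ g"
    and "g = [] \<or> g \<notin> lists marked_brackets"
    using assms(1-3) unfolding bracket_chain_def by blast
  with assms(4,5) show ?thesis by auto
qed

lemma bracket_chain_imp_deterministic:
  assumes "bracket_chain (marked_lang \<alpha>)"
  shows "\<not> not_deterministic \<alpha>"
proof
  assume "not_deterministic \<alpha>"
  then obtain \<rho>1 \<rho>2 r s1 s2 \<gamma>1 \<gamma>2 where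
    \<rho>: "\<rho>1 \<in> marked_lang \<alpha>" "\<rho>2 \<in> marked_lang \<alpha>" and
    \<gamma>: "\<gamma>1 \<in> lists marked_brackets" "\<gamma>2 \<in> lists marked_brackets" and
    disj: "(\<exists>a i j. \<rho>1 = r @ \<gamma>1 @ (Ter a, i) # s1 \<and> \<rho>2 = r @ \<gamma>2 @ (Ter a, j) # s2 \<and> i \<noteq> j) \<or>
       (\<exists>x \<chi> i j. \<rho>1 = r @ \<gamma>1 @ (Var x, i) # s1 \<and> \<rho>2 = r @ \<gamma>2 @ (\<chi>, j) # s2 \<and>
          \<not> is_bracket \<chi> \<and> i \<noteq> j) \<or>
       (\<exists>\<chi> i. \<rho>1 = r @ \<gamma>1 @ (\<chi>, i) # s1 \<and> \<rho>2 = r @ \<gamma>2 @ (\<chi>, i) # s2 \<and>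
          \<not> is_bracket \<chi> \<and> \<gamma>1 \<noteq> \<gamma>2) \<or>
       (\<rho>1 = r @ \<gamma>1 \<and> \<rho>2 = r @ \<gamma>2 \<and> \<gamma>1 \<noteq> \<gamma>2)"
    unfolding not_deterministic_def by (elim bexE exE) (rule that)
  have nb: "\<gamma>1 = \<gamma>2 \<and> (c, i) = (d, j)"
    if "\<rho>1 = r @ \<gamma>1 @ (c, i) # s1" "\<rho>2 = r @ \<gamma>2 @ (d, j) # s2" "\<not> is_bracket c" "\<not> is_bracket d"
    for c d i j
    by (rule bracket_chain_first_non_bracket[OF assms, of r _ _ s1 _ _ s2])
       (use that \<rho> \<gamma> in \<open>auto simp: marked_brackets_def\<close>)
  have suf: "\<gamma>1 = \<gamma>2" if "\<rho>1 = r @ \<gamma>1" "\<rho>2 = r @ \<gamma>2"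
    using bracket_chain_bracket_suffix[OF assms] that \<rho> \<gamma> by blast
  from disj consider
      (letter) a i j where "\<rho>1 = r @ \<gamma>1 @ (Ter a, i) # s1" "\<rho>2 = r @ \<gamma>2 @ (Ter a, j) # s2" "i \<noteq> j"
    | (var) x \<chi> i j where "\<rho>1 = r @ \<gamma>1 @ (Var x, i) # s1" "\<rho>2 = r @ \<gamma>2 @ (\<chi>, j) # s2"
        "\<not> is_bracket \<chi>" "i \<noteq> j"
    | (same) \<chi> i where "\<rho>1 = r @ \<gamma>1 @ (\<chi>, i) # s1" "\<rho>2 = r @ \<gamma>2 @ (\<chi>, i) # s2"
        "\<not> is_bracket \<chi>" "\<gamma>1 \<noteq> \<gamma>2"
    | (stop) "\<rho>1 = r @ \<gamma>1" "\<rho>2 = r @ \<gamma>2" "\<gamma>1 \<noteq> \<gamma>2"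
    by blast
  then show False
  proof cases
    case letter
    from nb[OF letter(1,2)] letter(3) show False by simp
  next
    case var
    from nb[OF var(1,2)] var(3,4) show False by simp
  next
    case same
    from nb[OF same(1,2)] same(3,4) show False by simp
  next
    case stop
    from suf[OF stop(1,2)] stop(3) show False by simp
  qed
qed

lemma bracket_chain_singleton: "bracket_chain {u}"
  by (simp add: bracket_chain_def)

lemma bracket_chain_conc:
  assumes "bracket_chain M"
  shows "bracket_chain (conc {u} M)"
  using assms unfolding bracket_chain_def conc_def by fastforce

lemma bracket_chain_insert_Nil:
  assumes "bracket_chain M" and "\<And>u. u \<in> M \<Longrightarrow> u = [] \<or> u \<notin> lists marked_brackets"
  shows "bracket_chain (insert [] M)"
  unfolding bracket_chain_def
proof (intro ballI)
  fix u v assume uv: "u \<in> insert [] M" "v \<in> insert [] M"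
  show "\<exists>g. (u = v @ g \<or> v = u @ g) \<and> (g = [] \<or> g \<notin> lists marked_brackets)"
  proof (cases "u \<in> M \<and> v \<in> M")
    case True
    with assms(1) show ?thesis by (simp add: bracket_chain_def)
  next
    case False
    with uv have "u = [] \<or> v = []" by blast
    then show ?thesis using uv assms(2) by (metis append_Nil insertE)
  qed
qed

lemma lplus_singleton_insert_Nil:
  "insert [] (lplus {w}) = range (\<lambda>n. concat (replicate n w))"
proof -
  have "lplus {w} \<subseteq> range (\<lambda>n. concat (replicate n w))"
  proof
    fix u assume "u \<in> lplus {w}"
    then obtain ws where u: "u = concat ws" and "set ws \<subseteq> {w}"
      unfolding lplus_def by blast
    then have "\<And>v. v \<in> set ws \<Longrightarrow> v = w" by blast
    then have "ws = replicate (length ws) w" by (intro replicate_eqI) simp_all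
    then have "u = concat (replicate (length ws) w)"
      unfolding u by (rule arg_cong)
    then show "u \<in> range (\<lambda>n. concat (replicate n w))" by (rule range_eqI)
  qed
  moreover have "concat (replicate (Suc n) w) \<in> lplus {w}" for n
    unfolding lplus_def by (intro CollectI exI[of _ "replicate (Suc n) w"]) auto
  then have "concat (replicate n w) \<in> insert [] (lplus {w})" for n
    by (cases n) (simp, blast)
  moreover have "[] = concat (replicate 0 w)" by simp
  ultimately show ?thesis by blast
qed

text \<open>The surplus of a power of \<open>w\<close> over a smaller one is itself a power of
  \<open>w\<close>, hence empty or with a non-bracket inside.\<close>

lemma bracket_chain_iterates:
  assumes "w \<notin> lists marked_brackets"
  shows "bracket_chain (range (\<lambda>n. concat (replicate n w)))"
proof -
  have *: "\<exists>g. concat (replicate (m + d) w) = concat (replicate m w) @ g \<and>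
      (g = [] \<or> g \<notin> lists marked_brackets)" for m d
  proof (intro exI conjI)
    show "concat (replicate (m + d) w) = concat (replicate m w) @ concat (replicate d w)"
      by (simp only: replicate_add concat_append)
    show "concat (replicate d w) = [] \<or> concat (replicate d w) \<notin> lists marked_brackets"
      using assms by (cases d) auto
  qed
  show ?thesis
    unfolding bracket_chain_def
  proof (intro ballI, elim rangeE)
    fix u v m n
    assume "u = concat (replicate m w)" "v = concat (replicate n w)"
    then show "\<exists>g. (u = v @ g \<or> v = u @ g) \<and> (g = [] \<or> g \<notin> lists marked_brackets)"
      using *[of m "n - m"] *[of n "m - n"] by (cases "m \<le> n") auto
  qed
qed


section \<open>Assignments between variables\<close>

text \<open>The value that a reference to \<open>x\<close> yields right after \<open>p\<close>. Thus
  \<open>val p\<close> acts as the store reached after \<open>p\<close>, and dereferencing becomes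
  the execution of a program.\<close>

definition val :: "('a, 'v) symb list \<Rightarrow> 'v \<Rightarrow> 'a list" where
  "val p x = (case nearest_binding x p of None \<Rightarrow> []
     | Some (u, v) \<Rightarrow> deref_from (u @ [Opn x]) v)"

lemma deref_from_Var: "deref_from p (Var x # r) = val p x @ deref_from (p @ [Var x]) r"
  by (simp add: val_def)

declare deref_from.simps(3) [simp del]

lemma deref_from_append:
  "deref_from p (r @ s) = deref_from p r @ deref_from (p @ r) s"
proof (induction r arbitrary: p)
  case (Cons c r)
  then show ?case by (cases c) (simp_all add: deref_from_Var)
qed simp

text \<open>Only the closing bracket of \<open>x\<close> completes a new factor; even after
  \<open>Opn x\<close> the old value stays in force until then.\<close>

lemma nearest_binding_snoc:
  assumes "s \<noteq> Cls x"
  shows "nearest_binding x (p @ [s]) = nearest_binding x p"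
  using assms by (simp add: nearest_binding_def)

lemma val_snoc: "s \<noteq> Cls x \<Longrightarrow> val (p @ [s]) x = val p x"
  by (simp add: val_def nearest_binding_snoc)

lemma val_other_binding:
  assumes "x \<noteq> y" and "s \<noteq> Cls x"
  shows "val (p @ [Opn y, s, Cls y]) x = val p x"
  using assms val_snoc[of "Cls y" x "p @ [Opn y, s]"] val_snoc[of s x "p @ [Opn y]"]
    val_snoc[of "Opn y" x p] by simp

lemma val_binding:
  assumes "\<not> is_bracket s"
  shows "val (p @ [Opn x, s, Cls x]) x = deref_from (p @ [Opn x]) [s]"
  using assms by (cases s) (simp_all add: val_def nearest_binding_def)

lemma val_bracket_free:
  assumes "set p \<subseteq> range Ter"
  shows "val p x = []"
  using assms
proof (induction p rule: rev_induct)
  case Nil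
  show ?case by (simp add: val_def nearest_binding_def)
next
  case (snoc s p)
  then show ?case by (auto simp: val_snoc)
qed

section \<open>Straight-line programs and the ref-words they stand for\<close>

datatype 'v instr = Read 'v | Copy 'v 'v

fun src :: "'v instr \<Rightarrow> 'v" where
  "src (Read z) = z"
| "src (Copy x z) = z"

fun upd :: "('v \<Rightarrow> 'a list) \<Rightarrow> 'v instr \<Rightarrow> 'v \<Rightarrow> 'a list" where
  "upd \<sigma> (Read z) = \<sigma>"
| "upd \<sigma> (Copy x z) = \<sigma>(x := \<sigma> z)"

text \<open>A \<open>Copy\<close> emits the value of its source just as a \<open>Read\<close> does,
  since the content of a binding is also part of the output. Moving values around therefore costs
  letters.\<close>

fun emit :: "('v \<Rightarrow> 'a list) \<Rightarrow> 'v instr list \<Rightarrow> 'a list" where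
  "emit \<sigma> [] = []"
| "emit \<sigma> (i # is) = \<sigma> (src i) @ emit (upd \<sigma> i) is"

fun instr_word :: "'v instr \<Rightarrow> ('a, 'v) symb list" where
  "instr_word (Read z) = [Var z]"
| "instr_word (Copy x z) = [Opn x, Var z, Cls x]"

fun instr_regex :: "'v instr \<Rightarrow> ('a, 'v) regex" where
  "instr_regex (Read z) = Ref z"
| "instr_regex (Copy x z) = Bind x (Ref z)"

definition prog_word :: "'v instr list \<Rightarrow> ('a, 'v) symb list" where
  "prog_word is = concat (map instr_word is)"

definition prog_regex :: "'v instr list \<Rightarrow> ('a, 'v) regex" where
  "prog_regex is = foldr (\<lambda>i. Cat (instr_regex i)) is Eps"

lemma deref_from_instr_word: "deref_from p (instr_word i) = val p (src i)"
  by (cases i) (simp_all add: deref_from_Var val_snoc)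

lemma val_instr_word: "val (p @ instr_word i) = upd (val p) i"
  by (cases i) (auto simp: val_snoc val_binding val_other_binding deref_from_Var)

text \<open>With \<open>val_prog_word\<close>, this replaces ref-words by output and store: from
  here on it suffices to compute with \<open>emit\<close> and \<open>upd\<close>.\<close>

lemma deref_from_prog_word: "deref_from p (prog_word is) = emit (val p) is"
proof (induction "is" arbitrary: p)
  case (Cons i "is")
  then show ?case
    by (simp add: prog_word_def deref_from_append deref_from_instr_word val_instr_word)
qed (simp add: prog_word_def)

lemma val_prog_word: "val (p @ prog_word is) = foldl upd (val p) is"
proof (induction "is" arbitrary: p)
  case (Cons i "is")
  from Cons[of "p @ instr_word i"] show ?case by (simp add: prog_word_def val_instr_word)
qed (simp add: prog_word_def)

lemma emit_append: "emit \<sigma> (is @ js) = emit \<sigma> is @ emit (foldl upd \<sigma> is) js"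
  by (induction "is" arbitrary: \<sigma>) simp_all

lemma emit_Read: "emit \<sigma> (map Read zs) = concat (map \<sigma> zs)"
  by (induction zs) simp_all

lemma foldl_upd_Read: "foldl upd \<sigma> (map Read zs) = \<sigma>"
  by (induction zs) simp_all

lemma conc_singletons: "conc {u} {v} = {u @ v}"
  by (auto simp: conc_def)

lemma ref_lang_prog_regex: "ref_lang (prog_regex is) = {prog_word is}"
proof (induction "is")
  case (Cons i "is")
  then show ?case
    by (cases i) (simp_all add: prog_regex_def prog_word_def conc_singletons)
qed (simp add: prog_regex_def prog_word_def)

text \<open>A program offers no choice, so it generates one marked word. Each instruction
  contributes a variable reference, which is a non-bracket.\<close>

lemma marked_prog_regex:
  fixes "is" :: "'v instr list"
  shows "\<exists>w. rexp_lang (mark n (rexp_of (prog_regex is :: ('a, 'v) regex))) = {w} \<and>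
    (is \<noteq> [] \<longrightarrow> w \<notin> lists marked_brackets)"
proof (induction "is" arbitrary: n)
  case (Cons i "is")
  let ?i = "instr_regex i :: ('a, 'v) regex"
  obtain w where "rexp_lang (mark (n + length (atoms (rexp_of ?i)))
      (rexp_of (prog_regex is :: ('a, 'v) regex))) = {w}"
    using Cons by blast
  then show ?case
    by (cases i) (simp_all add: prog_regex_def conc_singletons marked_brackets_def)
qed (simp add: prog_regex_def)

lemma prog_regex_in_RX_core:
  assumes "\<And>x z. Copy x z \<in> set is \<Longrightarrow> x \<noteq> z"
  shows "prog_regex is \<in> RX_core \<Sigma>"
  using assms
proof (induction "is")
  case (Cons i "is")
  then have "instr_regex i \<in> RX_core \<Sigma>" by (cases i) (auto intro: RX_core.intros)
  with Cons show ?case by (auto simp: prog_regex_def intro: RX_core.intros)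
qed (auto simp: prog_regex_def intro: RX_core.intros)


section \<open>Cyclic shifting of a one-letter token\<close>

text \<open>The copies run from high to low indices, so each source is read before it is
  overwritten, and the effect is a simultaneous move by one position.\<close>

fun shift :: "(nat \<Rightarrow> 'v) \<Rightarrow> nat \<Rightarrow> 'v instr list" where
  "shift x 0 = []"
| "shift x (Suc n) = Copy (x (Suc n)) (x n) # shift x n"

lemma Copy_shift: "Copy y z \<in> set (shift x n) \<Longrightarrow> \<exists>i. y = x (Suc i) \<and> z = x i"
  by (induction n) auto

lemma foldl_upd_shift:
  assumes "inj x"
  shows "foldl upd \<sigma> (shift x n) (x j) = (if 0 < j \<and> j \<le> n then \<sigma> (x (j - 1)) else \<sigma> (x j))"
proof (induction n arbitrary: \<sigma>)
  case (Suc n)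
  then show ?case using assms by (auto simp: inj_eq le_Suc_eq)
qed simp

text \<open>By the descending order, every copy emits the original value of its source.\<close>

lemma length_emit_shift:
  assumes "inj x"
  shows "length (emit \<sigma> (shift x n)) = (\<Sum>j<n. length (\<sigma> (x j)))"
proof (induction n arbitrary: \<sigma>)
  case (Suc n)
  have "(\<Sum>j<n. length ((\<sigma>(x (Suc n) := \<sigma> (x n))) (x j))) = (\<Sum>j<n. length (\<sigma> (x j)))"
    using assms by (intro sum.cong) (auto simp: inj_eq)
  with Suc show ?case by (simp del: fun_upd_apply)
qed simp

text \<open>For \<open>A = {a}\<close>, this and \<open>set_emit\<close> ensure that outputs are
  determined by their lengths.\<close>

lemma set_upd:
  assumes "\<And>y. set (\<sigma> y) \<subseteq> A"
  shows "set (foldl upd \<sigma> is y) \<subseteq> A"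
  using assms
proof (induction "is" arbitrary: \<sigma>)
  case (Cons i "is")
  have "set (upd \<sigma> i y) \<subseteq> A" for y
    using Cons.prems by (cases i) auto
  with Cons.IH show ?case by simp
qed simp

lemma set_emit:
  assumes "\<And>y. set (\<sigma> y) \<subseteq> A"
  shows "set (emit \<sigma> is) \<subseteq> A"
  using assms
proof (induction "is" arbitrary: \<sigma>)
  case (Cons i "is")
  have "set (upd \<sigma> i y) \<subseteq> A" for y
    using Cons.prems by (cases i) auto
  with Cons show ?case by simp
qed simp

text \<open>\<open>x k\<close> is the auxiliary variable.\<close>

definition rotate_prog :: "(nat \<Rightarrow> 'v) \<Rightarrow> nat \<Rightarrow> (nat \<Rightarrow> nat) \<Rightarrow> 'v instr list" where
  "rotate_prog x k e = shift x k @ [Copy (x 0) (x k)] @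
     map Read (concat (map (\<lambda>j. replicate (e j) (x j)) [0..<k]))"

text \<open>Nothing is demanded of the auxiliary \<open>x k\<close>: for \<open>0 < k\<close> the
  shift begins by overwriting it.\<close>

definition token :: "(nat \<Rightarrow> 'v) \<Rightarrow> nat \<Rightarrow> 'a \<Rightarrow> nat \<Rightarrow> ('v \<Rightarrow> 'a list) \<Rightarrow> bool" where
  "token x k a i \<sigma> \<longleftrightarrow> (\<forall>j<k. \<sigma> (x j) = (if j = i then [a] else []))"

text \<open>The shift saves the old \<open>x (k - 1)\<close> in \<open>x k\<close>, from where the
  last copy brings it to \<open>x 0\<close>. The reads do not alter the store.\<close>

lemma token_rotate_prog:
  assumes "inj x" and "i < k" and "token x k a i \<sigma>"
  shows "token x k a (Suc i mod k) (foldl upd \<sigma> (rotate_prog x k e))"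
  using assms
  by (auto simp: token_def rotate_prog_def foldl_upd_Read foldl_upd_shift inj_eq mod_Suc)

lemma length_concat_map_replicate:
  "length (concat (map f (concat (map (\<lambda>j. replicate (e j) (x j)) [0..<k])))) =
    (\<Sum>j<k. e j * length (f (x j)))"
  by (induction k) (simp_all add: length_concat sum_list_replicate)

text \<open>The shift emits the token once, the copy back to \<open>x 0\<close> emits it again
  exactly on wrapping around, and the reads emit it \<open>e\<close> times at its new
  position.\<close>

lemma length_emit_rotate_prog:
  assumes "inj x" and "i < k" and "token x k a i \<sigma>"
  shows "length (emit \<sigma> (rotate_prog x k e)) =
    Suc (e (Suc i mod k)) + (if Suc i mod k = 0 then 1 else 0)"
proof -
  \<comment> \<open>The store after all copies; as reads leave it alone, it equals the store after
    the whole program.\<close>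
  let ?\<tau> = "foldl upd \<sigma> (shift x k @ [Copy (x 0) (x k)])"
  have \<tau>: "?\<tau> (x j) = (if j = Suc i mod k then [a] else [])" if "j < k" for j
    using token_rotate_prog[OF assms, of e] that
    by (simp add: token_def rotate_prog_def foldl_upd_Read)
  have "(\<Sum>j<k. length (\<sigma> (x j))) = (\<Sum>j<k. if j = i then 1 else 0)"
    using assms(3) by (intro sum.cong) (auto simp: token_def)
  then have 1: "length (emit \<sigma> (shift x k)) = 1"
    using assms by (simp add: length_emit_shift)
  have 2: "length (foldl upd \<sigma> (shift x k) (x k)) = (if Suc i mod k = 0 then 1 else 0)"
    using assms by (auto simp: foldl_upd_shift token_def mod_Suc)
  have "length (concat (map ?\<tau> (concat (map (\<lambda>j. replicate (e j) (x j)) [0..<k])))) =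
      (\<Sum>j<k. e j * length (?\<tau> (x j)))"
    by (rule length_concat_map_replicate)
  also have "\<dots> = (\<Sum>j<k. if j = Suc i mod k then e j else 0)"
    using \<tau> by (intro sum.cong) auto
  also have "\<dots> = e (Suc i mod k)"
    using assms(2) by simp
  finally have 3: "length (concat (map ?\<tau> (concat (map (\<lambda>j. replicate (e j) (x j)) [0..<k])))) =
      e (Suc i mod k)" .
  show ?thesis
    using 1 2 3 by (simp add: rotate_prog_def emit_append emit_Read)
qed


section \<open>Unary languages\<close>

text \<open>Admitting any bracket-free context \<open>p\<close> makes the notion stable under prefixing letters.\<close>

definition represents :: "'a \<Rightarrow> ('a, 'v) regex \<Rightarrow> nat set \<Rightarrow> bool" where
  "represents a \<alpha> N \<longleftrightarrow> \<alpha> \<in> RX_core {a} \<and>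
     (\<forall>n. bracket_chain (rexp_lang (mark n (rexp_of \<alpha>)))) \<and>
     (\<forall>p. set p \<subseteq> range Ter \<longrightarrow>
        deref_from p ` ref_lang \<alpha> = (\<lambda>n. replicate n a) ` N)"

lemma represents_lang:
  fixes \<alpha> :: "('a, 'v) regex"
  assumes "represents a \<alpha> N"
  shows "\<alpha> \<in> DRX {a}" and "lang \<alpha> = (\<lambda>n. replicate n a) ` N"
proof -
  show "\<alpha> \<in> DRX {a}"
    using assms bracket_chain_imp_deterministic[of \<alpha>]
    by (auto simp: represents_def DRX_def RX_def marked_lang_def)
  have "lang \<alpha> = deref_from [] ` ref_lang \<alpha>"
    by (auto simp: lang_def deref_def)
  then show "lang \<alpha> = (\<lambda>n. replicate n a) ` N"
    using assms by (simp add: represents_def)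
qed

section \<open>Prefixing letters and shifting sets of lengths\<close>

lemma represents_Eps: "represents a Eps {0}"
  by (simp add: represents_def RX_core.intros bracket_chain_singleton)

lemma represents_Cat_Lit:
  assumes "represents a \<alpha> N"
  shows "represents a (Cat (Lit a) \<alpha>) (Suc ` N)"
proof -
  have "deref_from p ` conc {[Ter a]} (ref_lang \<alpha>) = (\<lambda>n. replicate n a) ` Suc ` N"
    if "set p \<subseteq> range Ter" for p
  proof -
    have "conc {[Ter a]} (ref_lang \<alpha>) = (#) (Ter a) ` ref_lang \<alpha>"
      by (auto simp: conc_def)
    then have "deref_from p ` conc {[Ter a]} (ref_lang \<alpha>)
        = (#) a ` deref_from (p @ [Ter a]) ` ref_lang \<alpha>"
      by (simp add: image_image)
    also have "\<dots> = (#) a ` (\<lambda>n. replicate n a) ` N"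
      using assms that by (simp add: represents_def)
    also have "\<dots> = (\<lambda>n. replicate n a) ` Suc ` N"
      by (simp add: image_image)
    finally show ?thesis .
  qed
  with assms show ?thesis
    by (auto simp: represents_def intro: RX_core.intros bracket_chain_conc)
qed

text \<open>The second premise keeps the new word \<open>[]\<close> from differing from another word
  by brackets alone; below, a leading letter provides it.\<close>

lemma represents_Alt_Eps:
  assumes "represents a \<alpha> N"
    and "\<And>n u. u \<in> rexp_lang (mark n (rexp_of \<alpha>)) \<Longrightarrow> u \<notin> lists marked_brackets"
  shows "represents a (Alt Eps \<alpha>) (insert 0 N)"
proof -
  have "bracket_chain (insert [] (rexp_lang (mark n (rexp_of \<alpha>))))" for n
    using assms by (intro bracket_chain_insert_Nil) (auto simp: represents_def)
  with assms(1) show ?thesis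
    by (simp add: represents_def RX_core.intros)
qed

lemma represents_shift_Suc:
  fixes \<alpha> :: "('a, 'v) regex"
  assumes "represents a \<alpha> {n. Suc n \<in> S}"
  shows "\<exists>\<beta> :: ('a, 'v) regex. represents a \<beta> S"
proof (cases "0 \<in> S")
  case True
  have "u \<notin> lists marked_brackets"
    if "u \<in> rexp_lang (mark n (rexp_of (Cat (Lit a) \<alpha>)))" for n u
    using that by (auto simp: conc_def marked_brackets_def)
  from represents_Alt_Eps[OF represents_Cat_Lit[OF assms] this]
  have "represents a (Alt Eps (Cat (Lit a) \<alpha>)) (insert 0 (Suc ` {n. Suc n \<in> S}))" .
  moreover have "insert 0 (Suc ` {n. Suc n \<in> S}) = S"
    using True by (auto simp: image_iff) (metis not0_implies_Suc)
  ultimately show ?thesis by auto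
next
  case False
  then have "Suc ` {n. Suc n \<in> S} = S"
    by (auto simp: image_iff) (metis not0_implies_Suc)
  then show ?thesis using represents_Cat_Lit[OF assms] by auto
qed

text \<open>An initial segment of \<open>S\<close> can be restored letter by letter, with
  \<open>Eps\<close> as an alternative at each element of \<open>S\<close>. So only a tail of
  \<open>S\<close> has to be represented.\<close>

lemma represents_shift:
  fixes \<alpha> :: "('a, 'v) regex"
  assumes "represents a \<alpha> {n. n + m \<in> S}"
  shows "\<exists>\<beta> :: ('a, 'v) regex. represents a \<beta> S"
  using assms
proof (induction m arbitrary: \<alpha>)
  case (Suc m)
  then show ?case using represents_shift_Suc[of a \<alpha> "{n. n + m \<in> S}"] by auto
qed auto

lemma represents_UNIV: "\<exists>\<alpha> :: ('a, 'v) regex. represents a \<alpha> UNIV"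
proof -
  have *: "insert [] (lplus {[s]}) = range (\<lambda>n. replicate n s)" for s :: 's
  proof -
    have "concat (replicate n [s]) = replicate n s" for n by (induction n) auto
    then show ?thesis by (simp add: lplus_singleton_insert_Nil)
  qed
  let ?\<alpha> = "Alt Eps (Iter (Lit a)) :: ('a, 'v) regex"
  have "bracket_chain (rexp_lang (mark n (rexp_of ?\<alpha>)))" for n
    using bracket_chain_iterates[of "[(Ter a, n)]"]
    by (simp add: lplus_singleton_insert_Nil marked_brackets_def)
  moreover have "deref_from p (replicate n (Ter a)) = replicate n a"
    for n and p :: "('a, 'v) symb list"
    by (induction n arbitrary: p) auto
  ultimately have "represents a ?\<alpha> UNIV"
    by (simp add: represents_def RX_core.intros * image_image)
  then show ?thesis ..
qed

section \<open>A regex for cyclically repeating gaps\<close>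

lemma represents_cyclic_gaps:
  assumes "0 < k" and "h 0 = 1"
    and h_Suc: "\<And>n. h (Suc n) =
      h n + Suc (e (Suc n mod k)) + (if Suc n mod k = 0 then 1 else 0)"
  shows "\<exists>\<alpha> :: ('a, 'v :: infinite) regex. represents a \<alpha> (range h)"
proof -
  obtain x :: "nat \<Rightarrow> 'v" where x: "inj x"
    using infinite_UNIV infinite_countable_subset by blast
  let ?w = "rotate_prog x k e"
  \<comment> \<open>This binding puts the token on \<open>x 0\<close> and also emits one letter,
    which accounts for \<open>h 0 = 1\<close>.\<close>
  let ?start = "[Opn (x 0), Ter a, Cls (x 0)] :: ('a, 'v) symb list"
  let ?\<alpha> = "Cat (Bind (x 0) (Lit a)) (Alt Eps (Iter (prog_regex ?w))) :: ('a, 'v) regex"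
  let ?it = "\<lambda>n. concat (replicate n (prog_word ?w :: ('a, 'v) symb list))"
  have core: "?\<alpha> \<in> RX_core {a}"
  proof -
    have "y \<noteq> z" if "Copy y z \<in> set ?w" for y z
      using that assms(1) x by (auto simp: rotate_prog_def inj_eq dest!: Copy_shift)
    then show ?thesis by (auto intro!: RX_core.intros prog_regex_in_RX_core)
  qed
  have chain: "bracket_chain (rexp_lang (mark n (rexp_of ?\<alpha>)))" for n
  proof -
    \<comment> \<open>The initial binding uses up three marks: two brackets and a letter.\<close>
    obtain w where "rexp_lang (mark (n + 3) (rexp_of (prog_regex ?w :: ('a, 'v) regex))) = {w}"
      "w \<notin> lists marked_brackets"
      using marked_prog_regex[of "n + 3" ?w] by (auto simp: rotate_prog_def)
    then show ?thesis
      by (simp add: conc_singletons lplus_singleton_insert_Nil bracket_chain_conc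
          bracket_chain_iterates eval_nat_numeral)
  qed
  have refs: "ref_lang ?\<alpha> = range (\<lambda>n. ?start @ ?it n)"
    by (auto simp: conc_def ref_lang_prog_regex lplus_singleton_insert_Nil)
  \<comment> \<open>Invariant of the loop: the output so far, the position of the token, and that
    all stored values are over \<open>{a}\<close>, so that lengths determine later outputs.\<close>
  have run: "deref_from p (?start @ ?it n) = replicate (h n) a \<and>
      token x k a (n mod k) (val (p @ ?start @ ?it n)) \<and>
      (\<forall>y. set (val (p @ ?start @ ?it n) y) \<subseteq> {a})"
    if p: "set p \<subseteq> range Ter" for p n
  proof (induction n)
    case 0
    have "val (p @ ?start) (x j) = (if j = 0 then [a] else [])" for j
      using x p by (auto simp: val_binding val_other_binding inj_eq val_bracket_free)
    moreover have "set (val (p @ ?start) y) \<subseteq> {a}" for y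
      using p by (cases "y = x 0") (auto simp: val_binding val_other_binding val_bracket_free)
    ultimately show ?case using assms(2) by (simp add: token_def)
  next
    case (Suc n)
    let ?\<sigma> = "val (p @ ?start @ ?it n)"
    have it: "?it (Suc n) = ?it n @ prog_word ?w"
    proof -
      have "replicate (Suc n) (prog_word ?w) = replicate n (prog_word ?w) @ [prog_word ?w]"
        by (simp add: replicate_append_same)
      then show ?thesis by (metis concat_append concat.simps append_Nil2)
    qed
    have \<sigma>: "token x k a (n mod k) ?\<sigma>" "\<And>y. set (?\<sigma> y) \<subseteq> {a}" "n mod k < k"
      using Suc assms(1) by simp_all
    have store: "val (p @ ?start @ ?it (Suc n)) = foldl upd ?\<sigma> ?w"
      unfolding it using val_prog_word[of "p @ ?start @ ?it n" ?w] by simp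
    have "deref_from p (?start @ ?it (Suc n)) =
        deref_from p (?start @ ?it n) @ emit ?\<sigma> ?w"
      unfolding it using deref_from_append[of p "?start @ ?it n" "prog_word ?w"]
      by (simp only: append_assoc deref_from_prog_word)
    moreover have "emit ?\<sigma> ?w = replicate (length (emit ?\<sigma> ?w)) a"
      using set_emit[of ?\<sigma> "{a}" ?w] \<sigma>(2) by (intro replicate_eqI) auto
    moreover have "length (emit ?\<sigma> ?w) = Suc (e (Suc n mod k)) + (if Suc n mod k = 0 then 1 else 0)"
      using length_emit_rotate_prog[OF x \<sigma>(3,1), of e] by (simp only: mod_Suc_eq)
    ultimately have "deref_from p (?start @ ?it (Suc n)) = replicate (h (Suc n)) a"
      using Suc by (metis h_Suc replicate_add add.assoc)
    moreover have "token x k a (Suc n mod k) (foldl upd ?\<sigma> ?w)"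
      using token_rotate_prog[OF x \<sigma>(3,1), of e] by (simp only: mod_Suc_eq)
    ultimately show ?case
      unfolding store using set_upd[of ?\<sigma> "{a}" ?w] \<sigma>(2) by blast
  qed
  have "represents a ?\<alpha> (range h)"
    unfolding represents_def refs
  proof (intro conjI allI impI)
    fix p :: "('a, 'v) symb list" assume "set p \<subseteq> range Ter"
    then show "deref_from p ` range (\<lambda>n. ?start @ ?it n) = (\<lambda>n. replicate n a) ` range h"
      using run unfolding image_image by (metis (no_types, lifting))
  qed (rule core chain)+
  then show ?thesis ..
qed

section \<open>Finite and eventually periodic sets of lengths\<close>

lemma represents_finite:
  assumes "finite S" "S \<noteq> {}"
  shows "\<exists>\<alpha> :: ('a, 'v) regex. represents a \<alpha> S"
proof (rule represents_shift)
  \<comment> \<open>Shifting by the maximum leaves only \<open>{0}\<close>, which \<open>Eps\<close>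
    represents.\<close>
  have "n + Max S \<in> S \<longleftrightarrow> n = 0" for n
    using Max_ge[OF assms(1), of "n + Max S"] Max_in[OF assms] by (cases "n = 0") auto
  then have "{n. n + Max S \<in> S} = {0}" by auto
  then show "represents a Eps {n. n + Max S \<in> S}" by (simp add: represents_Eps)
qed

text \<open>Translation by \<open>p\<close> maps \<open>A\<close> onto its elements from
  \<open>m + p\<close> on, so it commutes with passing to the next element.\<close>

lemma enumerate_periodic:
  fixes A :: "nat set"
  assumes "infinite A" and lb: "\<And>y. y \<in> A \<Longrightarrow> m \<le> y"
    and period: "\<And>y. m \<le> y \<Longrightarrow> y \<in> A \<longleftrightarrow> y + p \<in> A"
    and k: "enumerate A k = enumerate A 0 + p"
  shows "enumerate A (n + k) = enumerate A n + p"
proof (induction n)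
  case 0
  show ?case using k by simp
next
  case (Suc n)
  let ?g = "enumerate A"
  have gA: "?g i \<in> A" for i using assms(1) by (rule enumerate_in_set)
  have least: "?g (Suc i) = (LEAST s. s \<in> A \<and> ?g i < s)" for i
    using assms(1) by (rule enumerate_Suc'')
  have "(LEAST s. s \<in> A \<and> ?g n + p < s) = ?g (Suc n) + p"
  proof (rule Least_equality)
    show "?g (Suc n) + p \<in> A \<and> ?g n + p < ?g (Suc n) + p"
      using gA[of "Suc n"] period[of "?g (Suc n)"] lb[OF gA, of "Suc n"]
        enumerate_step[OF assms(1), of n] by simp
  next
    fix y assume y: "y \<in> A \<and> ?g n + p < y"
    then have "m \<le> y - p" using lb[OF gA, of n] by linarith
    moreover have "?g n < y - p" using y by linarith
    ultimately have "y - p \<in> A \<and> ?g n < y - p" using y period[of "y - p"] by simp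
    then have "?g (Suc n) \<le> y - p" unfolding least by (rule Least_le)
    with y show "?g (Suc n) + p \<le> y" by linarith
  qed
  then show ?case using least[of "n + k"] Suc by simp
qed

lemma represents_periodic:
  fixes S :: "nat set"
  assumes "infinite S" and "0 < p" and period: "\<And>n. t \<le> n \<Longrightarrow> n \<in> S \<longleftrightarrow> n + p \<in> S"
  shows "\<exists>\<alpha> :: ('a, 'v :: infinite) regex. represents a \<alpha> S"
proof (cases "\<exists>m. \<forall>n\<ge>m. n \<in> S")
  case True
  then obtain m where "\<forall>n\<ge>m. n \<in> S" ..
  then have "{n. n + m \<in> S} = UNIV" by simp
  with represents_UNIV represents_shift show ?thesis by metis
next
  case False
  then obtain b where b: "t \<le> b" "b \<notin> S" by blast
  \<comment> \<open>As the least element of \<open>S\<close> above the non-element \<open>b\<close>,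
    \<open>m\<close> has a predecessor outside \<open>S\<close>.\<close>
  define m where "m = (LEAST c. b < c \<and> c \<in> S)"
  have "\<exists>c. b < c \<and> c \<in> S"
    using assms(1) by (meson infinite_nat_iff_unbounded)
  then have m: "b < m" "m \<in> S"
    unfolding m_def by (metis (mono_tags, lifting) LeastI_ex)+
  \<comment> \<open>Shifting by \<open>q\<close> instead of \<open>m\<close> makes the first length
    1, as the initial binding requires.\<close>
  define q where "q = m - 1"
  have mq: "m = Suc q" using m by (simp add: q_def)
  have q: "t \<le> q" using b m by (simp add: mq)
  have "q \<notin> S"
  proof
    assume "q \<in> S"
    with b m mq have "b < q" by (metis less_antisym)
    with \<open>q \<in> S\<close> have "m \<le> q" unfolding m_def by (intro Least_le) simp
    then show False by (simp add: mq)
  qed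
  then have qp: "q + p \<notin> S" using period[OF q] by simp
  define A where "A = S \<inter> {m..}"
  have A_iff: "y \<in> A \<longleftrightarrow> y \<in> S \<and> m \<le> y" for y by (auto simp: A_def)
  have "S - {..<m} = A" by (auto simp: A_def)
  then have A: "infinite A" using assms(1) by (metis Diff_infinite_finite finite_lessThan)
  define g where "g = enumerate A"
  have g_ge: "m \<le> g n" and g_S: "g n \<in> S" for n
    using enumerate_in_set[OF A, of n] by (simp_all add: g_def A_iff)
  have g_Suc: "g n < g (Suc n)" for n
    unfolding g_def using A by (rule enumerate_step)
  have range_g: "range g = A" unfolding g_def using A by (rule range_enumerate)
  have g0: "g 0 = m"
    unfolding g_def enumerate_0 using m by (intro Least_equality) (auto simp: A_iff)
  have "m + p \<in> range g"
    using range_g period[of m] m q mq by (simp add: A_iff)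
  \<comment> \<open>\<open>k\<close> is the number of elements of \<open>S\<close> from
    \<open>m\<close> up to but excluding \<open>m + p\<close>.\<close>
  then obtain k where k: "g k = m + p" by auto
  have "0 < k" using k g0 assms(2) by (metis add_eq_self_zero gr0I less_irrefl)
  have g_add: "g (n + k) = g n + p" for n
    unfolding g_def
  proof (rule enumerate_periodic[OF A])
    show "m \<le> y" if "y \<in> A" for y using that by (simp add: A_iff)
    show "y \<in> A \<longleftrightarrow> y + p \<in> A" if "m \<le> y" for y
      using that period[of y] q mq by (simp add: A_iff)
    show "enumerate A k = enumerate A 0 + p" using k g0 by (simp add: g_def)
  qed
  have g_mult: "g (r + d * k) = g r + d * p" for r d
  proof (induction d)
    case (Suc d)
    then show ?case using g_add[of "r + d * k"] by (simp add: algebra_simps)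
  qed simp
  \<comment> \<open>The gap before \<open>m + p\<close> is at least 2, because its predecessor
    \<open>q + p\<close> is outside \<open>S\<close> like \<open>q\<close>.\<close>
  have wrap: "g (k - 1) + 2 \<le> m + p"
  proof -
    have "g (k - 1) < m + p" using g_Suc[of "k - 1"] k \<open>0 < k\<close> by simp
    moreover have "g (k - 1) \<noteq> q + p" using g_S qp by metis
    ultimately show ?thesis using mq by simp
  qed
  \<comment> \<open>Each gap minus the cost of moving the token there: two letters for
    \<open>j = 0\<close>, otherwise one. For \<open>j < k\<close> no subtraction truncates, by
    \<open>wrap\<close> and \<open>g_Suc\<close>.\<close>
  define e where "e j = (if j = 0 then m + p - g (k - 1) - 2 else g j - g (j - 1) - 1)" for j
  define h where "h n = g n - q" for n
  have "h (Suc n) = h n + Suc (e (Suc n mod k)) + (if Suc n mod k = 0 then 1 else 0)" for n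
  proof -
    \<comment> \<open>Subtracting \<open>d\<close> periods reduces the gap after \<open>g n\<close>
      to the one after \<open>g r\<close> with \<open>r < k\<close>.\<close>
    define r d where "r = n mod k" and "d = n div k"
    have n: "n = r + d * k" by (simp add: r_def d_def)
    have "r < k" using \<open>0 < k\<close> by (simp add: r_def)
    have gn: "g n = g r + d * p" "g (Suc n) = g (Suc r) + d * p"
      using g_mult[of r d] g_mult[of "Suc r" d] by (simp_all add: n)
    have mod: "Suc n mod k = (if Suc r = k then 0 else Suc r)"
      by (simp add: r_def mod_Suc)
    show ?thesis
    proof (cases "Suc r = k")
      case True
      then have "g (Suc r) = m + p" "r = k - 1" using k by auto
      then show ?thesis using True gn mod wrap g_ge[of r] mq by (simp add: h_def e_def)
    next
      case False
      then show ?thesis using gn mod g_Suc[of r] g_ge[of r] mq by (simp add: h_def e_def)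
    qed
  qed
  moreover have "h 0 = 1" by (simp add: h_def g0 mq)
  ultimately obtain \<alpha> :: "('a, 'v) regex" where \<alpha>: "represents a \<alpha> (range h)"
    using represents_cyclic_gaps[of k h e a] \<open>0 < k\<close> by blast
  have "range h = {n. n + q \<in> S}"
  proof (intro set_eqI iffI)
    fix n assume "n \<in> range h"
    then obtain i where "n = g i - q" by (auto simp: h_def)
    then show "n \<in> {n. n + q \<in> S}" using g_S[of i] g_ge[of i] mq by simp
  next
    fix n assume n: "n \<in> {n. n + q \<in> S}"
    \<comment> \<open>Starting one below \<open>m\<close> adds no length 0, so \<open>n + q\<close>
      is at least \<open>m\<close>.\<close>
    with \<open>q \<notin> S\<close> have "n \<noteq> 0" by (intro notI) simp
    with n have "n + q \<in> range g" by (simp add: range_g A_iff mq)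
    then obtain i where "g i = n + q" by auto
    then have "n = h i" by (simp add: h_def)
    then show "n \<in> range h" by simp
  qed
  with \<alpha> represents_shift show ?thesis by metis
qed

section \<open>Eventual periodicity of unary regular languages\<close>

lemma regular_unary:
  assumes "regular {a} L"
  obtains S t p where "L = (\<lambda>n. replicate n a) ` S" and "0 < (p :: nat)"
    and "\<And>n. t \<le> n \<Longrightarrow> n \<in> S \<longleftrightarrow> n + p \<in> S"
proof -
  obtain Q :: "nat set" and q0 F \<delta> where Q: "finite Q" "q0 \<in> Q" "\<forall>q\<in>Q. \<delta> q a \<in> Q"
    and L: "L = {w \<in> lists {a}. foldl \<delta> q0 w \<in> F}"
    using assms unfolding regular_def by auto
  define c where "c n = foldl \<delta> q0 (replicate n a)" for n
  have c_Suc: "c (Suc n) = \<delta> (c n) a" for n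
    using foldl_append[of \<delta> q0 "replicate n a" "[a]"] by (simp add: c_def replicate_append_same)
  have "c n \<in> Q" for n
    by (induction n) (use Q c_Suc in \<open>auto simp: c_def\<close>)
  \<comment> \<open>Pigeonhole: the run on powers of the letter stays in the finite
    \<open>Q\<close>, so it repeats a state and then cycles with period
    \<open>j - i\<close>.\<close>
  then have "\<not> inj c"
    using Q(1) by (metis finite_subset finite_imageD image_subsetI infinite_UNIV_nat)
  then obtain i j where ij: "i < j" "c i = c j"
    unfolding inj_def by (metis linorder_neqE_nat)
  have "c (i + n) = c (j + n)" for n
    by (induction n) (simp_all add: ij c_Suc)
  then have period: "c n = c (n + (j - i))" if "i \<le> n" for n
    using that ij(1) by (metis add.commute add_diff_assoc2 le_add_diff_inverse less_imp_le)
  have "L = (\<lambda>n. replicate n a) ` {n. c n \<in> F}"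
  proof (intro set_eqI iffI)
    fix w assume w: "w \<in> L"
    then have "w = replicate (length w) a" by (intro replicate_eqI) (auto simp: L)
    with w show "w \<in> (\<lambda>n. replicate n a) ` {n. c n \<in> F}"
      by (auto simp: L c_def image_iff intro!: exI[of _ "length w"])
  qed (auto simp: L c_def)
  then show thesis
  proof (rule that)
    show "0 < j - i" using ij(1) by simp
    show "n \<in> {n. c n \<in> F} \<longleftrightarrow> n + (j - i) \<in> {n. c n \<in> F}" if "i \<le> n" for n
      using period[OF that] by simp
  qed
qed

theorem theorem6:
  fixes \<Sigma> :: "'a set" and L :: "'a list set"
  assumes "card \<Sigma> = 1"
    and "regular \<Sigma> L"
  shows "L \<in> {lang \<alpha> | \<alpha> :: ('a, 'v :: infinite) regex. \<alpha> \<in> DRX \<Sigma>}"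
proof -
  obtain a where \<Sigma>: "\<Sigma> = {a}"
    using assms(1) by (metis card_1_singletonE)
  obtain S t p where L: "L = (\<lambda>n. replicate n a) ` S" and S: "0 < (p :: nat)"
    "\<And>n. t \<le> n \<Longrightarrow> n \<in> S \<longleftrightarrow> n + p \<in> S"
    using regular_unary[of a L] assms(2) \<Sigma> by metis
  show ?thesis
  proof (cases "S = {}")
    case True
    \<comment> \<open>This case is separate because \<open>represents\<close> demands a regex in
      \<open>RX_core\<close>, and such a regex has a nonempty ref-language.\<close>
    have "(Empty :: ('a, 'v) regex) \<in> DRX \<Sigma>" "lang (Empty :: ('a, 'v) regex) = L"
      by (simp_all add: DRX_def RX_def not_deterministic_def marked_lang_def lang_def L True)
    then show ?thesis by blast
  next
    case False
    then obtain \<alpha> :: "('a, 'v) regex" where "represents a \<alpha> S"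
      using represents_finite represents_periodic[OF _ S] by metis
    from represents_lang[OF this] have "\<alpha> \<in> DRX \<Sigma>" "L = lang \<alpha>"
      by (simp_all add: \<Sigma> L)
    then show ?thesis by blast
  qed
qed

end
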